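(* Let $X,Y,Z$ be nonempty words over $\{L,M,R\}$ with $XY=\overline{Y}Z$ (so $|X|=|Z|$). Then: (1) If $|X|=|Y|=|Z|$, then $X=\overline{Z}$, and the equation becomes $XY=\overline{Y}\,\overline{X}$. (2) If $|X|=|Z|<|Y|$, write $|Y|=q|X|+r$ with $0\le r<|X|$. Then: (a) if $q$ is even, there are (possibly empty) words $X_0,Y_0$ with $\overline{X}=Y_0X_0$, $Z=\overline{X_0}Y_0$ and $Y=(Y_0X_0\overline{Y_0X_0})^{q/2}Y_0$, and $Y$ is a broken alternating word; (b) if $q$ is odd, there are (possibly empty) words $X_0,Y_0$ with $X=Y_0X_0$, $Z=\overline{X_0}Y_0$ and $Y=(\overline{Y_0X_0}Y_0X_0)^{(q-1)/2}\,\overline{Y_0X_0}\,Y_0$, and $Y$ is a broken alternating word. (3) If $|X|=|Z|>|Y|$, then there is a word $X_1$ with $X=\overline{Y}X_1$ and $Z=X_1Y$.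
   Context: Words are finite sequences over the alphabet $\{L,M,R\}$; $|w|$ denotes length, and $w^k$ is the $k$-fold concatenation ($w^0$ is the empty word). The complement $\overline{w}$ is obtained letterwise from $\overline{R}=L$, $\overline{L}=R$, $\overline{M}=M$. A word $v$ is a left factor of a word $x$ if $x=vx_1$ for some (possibly empty) word $x_1$. A word $w$ is called a broken alternating word if it is of the form $w=(w_1\overline{w_1})^{n}w_0$, where $n$ is a positive integer and $w_0$ is a left factor of $w_1\overline{w_1}$.
   Formalization: In (2)(b), "Y is a broken alternating word" is claimed only for odd q ≥ 3; for q = 1 it is false as printed (X = LMM, Y = RMML, Z = MML), while the decompositions of X, Z and Y are still claimed for q = 1. *)

theory Defs
  imports "HOL-Library.Sublist"
begin

datatype letter = L | M | R

type_synonym word = "letter list"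

fun letter_compl :: "letter \<Rightarrow> letter" where
  "letter_compl L = R"
| "letter_compl M = M"
| "letter_compl R = L"

definition compl :: "word \<Rightarrow> word" where
  "compl w = map letter_compl w"

definition word_pow :: "word \<Rightarrow> nat \<Rightarrow> word" where
  "word_pow w k = concat (replicate k w)"

definition broken_alternating :: "word \<Rightarrow> bool" where
  "broken_alternating w \<longleftrightarrow>
     (\<exists>w1 w0 n. n > 0 \<and> prefix w0 (w1 @ compl w1) \<and> w = word_pow (w1 @ compl w1) n @ w0)"

(* The following instance of X Y = compl(Y) Z has |X| < |Y| and |Y| = 1 * |X| + 1, yet Y is not a
   broken alternating word. With n > 0 in the definition above, the claim "Y is a broken
   alternating word" therefore cannot hold for quotient q = 1. (Dropping n > 0 would make every
   word broken alternating: take n = 0 and w1 = w0 = w.) *)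
lemma quotient_one_counterexample:
  fixes X Y Z :: word
  defines "X \<equiv> [L, M, M]" and "Y \<equiv> [R, M, M, L]" and "Z \<equiv> [M, M, L]"
  shows "X @ Y = compl Y @ Z" and "length Y = 1 * length X + 1" and "\<not> broken_alternating Y"
proof -
  show "X @ Y = compl Y @ Z" "length Y = 1 * length X + 1"
    by (simp_all add: X_def Y_def Z_def compl_def)
  show "\<not> broken_alternating Y"
  proof
    assume "broken_alternating Y"
    then obtain w1 w0 n where n: "n > 0" and w0: "prefix w0 (w1 @ compl w1)"
      and Y: "Y = word_pow (w1 @ compl w1) n @ w0"
      unfolding broken_alternating_def by blast
    from n obtain k where "n = Suc k" by (cases n) auto
    with Y have Y': "Y = w1 @ compl w1 @ word_pow (w1 @ compl w1) k @ w0"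
      by (simp add: word_pow_def)
    show False
    proof (cases w1)
      case Nil
      then have "Y = []" using Y w0 by (simp add: word_pow_def compl_def)
      then show False by (simp add: Y_def)
    next
      case (Cons a u)
      then show False using Y'
        by (cases u) (auto simp: Y_def compl_def Cons_eq_append_conv append_eq_Cons_conv)
    qed
  qed
qed

end

theory Submission
  imports Defs
begin

text \<open>
  If \<open>X Y = \<^bold>Y Z\<close>, writing bold for the complement, and \<open>Y\<close> is at least as long as \<open>X\<close>, then
  cancelling \<open>X\<close> on the left gives \<open>Y = \<^bold>X Y'\<close> with \<open>\<^bold>X Y' = \<^bold>Y' Z\<close>: an equation of the same form in
  which \<open>X\<close> is complemented and the quotient \<open>q\<close> has dropped by one. Descending to \<open>q = 0\<close>, where
  \<open>\<^bold>Y\<close> is a left factor of \<open>X\<close>, yields the factorisations.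
\<close>

lemma letter_compl_involutive [simp]: "letter_compl (letter_compl a) = a"
  by (cases a) auto

lemma compl_compl [simp]: "compl (compl w) = w"
  by (simp add: compl_def comp_def)

lemma compl_append [simp]: "compl (u @ v) = compl u @ compl v"
  by (simp add: compl_def)

lemma length_compl [simp]: "length (compl w) = length w"
  by (simp add: compl_def)

lemma word_pow_0 [simp]: "word_pow w 0 = []"
  by (simp add: word_pow_def)

lemma word_pow_Suc: "word_pow w (Suc k) = w @ word_pow w k"
  by (simp add: word_pow_def)

text \<open>Conjugation of periods: a leading \<open>u\<close> migrates through the powers,
  exchanging \<open>v @ u\<close> for \<open>u @ v\<close>.\<close>

lemma append_word_pow_shift: "u @ word_pow (v @ u) k @ w = word_pow (u @ v) k @ u @ w"
  by (induction k) (simp_all add: word_pow_Suc)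

text \<open>Levi's lemma, with the lengths deciding which of the two factors is the prefix.\<close>

lemma append_eq_append_length_leE:
  assumes "xs @ ys = us @ vs" and "length us \<le> length xs"
  obtains ws where "xs = us @ ws" and "vs = ws @ ys"
proof -
  obtain ws where ws: "xs = us @ ws \<and> ws @ ys = vs \<or> xs @ ws = us \<and> ys = ws @ vs"
    using assms(1) unfolding append_eq_append_conv2 by blast
  have "ws = []" if "xs @ ws = us"
    using assms(2) by (simp flip: that)
  with ws show thesis
    by (intro that[of ws]) auto
qed

lemma compl_equation_reduce:
  assumes "X @ Y = compl Y @ Z" and "length X \<le> length Y"
  obtains Y' where "Y = compl X @ Y'" and "compl X @ Y' = compl Y' @ Z"
proof -
  obtain V where V: "compl Y = X @ V" "Y = V @ Z"
    using append_eq_append_length_leE[OF assms(1)[symmetric]] assms(2) by auto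
  have Y: "Y = compl X @ compl V"
    by (simp flip: V(1) compl_append)
  \<comment> \<open>The overlap \<open>V\<close> has \<open>compl Y = X @ V\<close> and
    \<open>Y = V @ Z\<close>; equating the two forms of \<open>Y\<close> gives the new equation with
    \<open>compl V\<close> in the role of \<open>Y\<close>.\<close>
  show thesis
    using Y V(2) by (intro that[of "compl V"]) simp_all
qed

text \<open>Each descent step complements \<open>X\<close> and leaves \<open>Z\<close> fixed, so the
  parity of \<open>q\<close> decides whether \<open>X\<close> or \<open>compl X\<close> is factored;
  hence the induction must generalise over \<open>X\<close> and \<open>Y\<close>.\<close>

lemma compl_equation_factorization:
  assumes "X @ Y = compl Y @ Z" and "length Y = q * length X + r" and "r < length X"
  shows "(even q \<longrightarrow>
           (\<exists>X0 Y0. compl X = Y0 @ X0 \<and> Z = compl X0 @ Y0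
              \<and> Y = word_pow (Y0 @ X0 @ compl (Y0 @ X0)) (q div 2) @ Y0))
       \<and> (odd q \<longrightarrow>
           (\<exists>X0 Y0. X = Y0 @ X0 \<and> Z = compl X0 @ Y0
              \<and> Y = word_pow (compl (Y0 @ X0) @ Y0 @ X0) ((q - 1) div 2)
                      @ compl (Y0 @ X0) @ Y0))"
  using assms
proof (induction q arbitrary: X Y)
  case 0
  then obtain X1 where "X = compl Y @ X1" "Z = X1 @ Y"
    using append_eq_append_length_leE[of X Y "compl Y" Z] by auto
  \<comment> \<open>This exhibits the witnesses \<open>Y0 = Y\<close> and
    \<open>X0 = compl X1\<close>; the power has exponent 0.\<close>
  then have "compl X = Y @ compl X1" "Z = compl (compl X1) @ Y"
    by simp_all
  then show ?case
    by auto
next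
  case (Suc q)
  then obtain Y' where Y: "Y = compl X @ Y'" and eq: "compl X @ Y' = compl Y' @ Z"
    using compl_equation_reduce[of X Y Z] by auto
  have "length Y' = q * length (compl X) + r" "r < length (compl X)"
    using Suc.prems(2,3) Y by simp_all
  note IH = Suc.IH[OF eq this]
  show ?case
  proof (cases "even q")
    case True
    then obtain X0 Y0 where X: "X = Y0 @ X0" and Z: "Z = compl X0 @ Y0"
      and Y': "Y' = word_pow (Y0 @ X0 @ compl (Y0 @ X0)) (q div 2) @ Y0"
      using IH by auto
    \<comment> \<open>The prepended \<open>compl X = compl (Y0 @ X0)\<close> is shifted through the
      power to its right end.\<close>
    have "Y = word_pow (compl (Y0 @ X0) @ Y0 @ X0) (q div 2) @ compl (Y0 @ X0) @ Y0"
      unfolding Y Y' using append_word_pow_shift[of "compl (Y0 @ X0)" "Y0 @ X0" "q div 2" Y0]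
      by (simp add: X)
    with True X Z show ?thesis
      by auto
  next
    case False
    then obtain X0 Y0 where X: "compl X = Y0 @ X0" and Z: "Z = compl X0 @ Y0"
      and Y': "Y' = word_pow (compl (Y0 @ X0) @ Y0 @ X0) ((q - 1) div 2)
                      @ compl (Y0 @ X0) @ Y0"
      using IH by auto
    have q: "Suc q div 2 = Suc ((q - 1) div 2)"
      using False by (auto elim: oddE)
    \<comment> \<open>The shift is now read from right to left: the trailing
      \<open>compl (Y0 @ X0)\<close> moves to the front and, with the prepended
      \<open>compl X = Y0 @ X0\<close>, completes one more period.\<close>
    have "Y = word_pow (Y0 @ X0 @ compl (Y0 @ X0)) (Suc q div 2) @ Y0"
      unfolding Y Y' q word_pow_Suc
      using append_word_pow_shift[of "compl (Y0 @ X0)" "Y0 @ X0" "(q - 1) div 2" Y0]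
      by (simp add: X)
    with False X Z show ?thesis
      by auto
  qed
qed

lemma broken_alternatingI:
  assumes "n > 0" and "prefix w0 (w1 @ compl w1)"
  shows "broken_alternating (word_pow (w1 @ compl w1) n @ w0)"
  using assms unfolding broken_alternating_def by blast

theorem proposition3p5:
  fixes X Y Z :: word
  assumes "X \<noteq> []" and "Y \<noteq> []" and "Z \<noteq> []"
    and "X @ Y = compl Y @ Z"
  shows "length X = length Z
    \<and> (length X = length Y \<and> length Y = length Z \<longrightarrow>
         X = compl Z \<and> X @ Y = compl Y @ compl X)
    \<and> (length X = length Z \<and> length Z < length Y \<longrightarrow>
         (\<forall>q r. length Y = q * length X + r \<and> 0 \<le> r \<and> r < length X \<longrightarrow>
            (even q \<longrightarrow>
               (\<exists>X0 Y0. compl X = Y0 @ X0 \<and> Z = compl X0 @ Y0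
                  \<and> Y = word_pow (Y0 @ X0 @ compl (Y0 @ X0)) (q div 2) @ Y0)
               \<and> broken_alternating Y)
          \<and> (odd q \<longrightarrow>
               (\<exists>X0 Y0. X = Y0 @ X0 \<and> Z = compl X0 @ Y0
                  \<and> Y = word_pow (compl (Y0 @ X0) @ Y0 @ X0) ((q - 1) div 2)
                          @ compl (Y0 @ X0) @ Y0)
               \<and> (q \<noteq> 1 \<longrightarrow> broken_alternating Y))))
    \<and> (length X = length Z \<and> length Z > length Y \<longrightarrow>
         (\<exists>X1. X = compl Y @ X1 \<and> Z = X1 @ Y))"
proof -
  have len: "length X = length Z"
    using arg_cong[OF assms(4), of length] by simp
  have equal: "X = compl Z \<and> X @ Y = compl Y @ compl X"
    if "length X = length Y"
    using assms(4) that by auto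
  have long: "(even q \<longrightarrow>
               (\<exists>X0 Y0. compl X = Y0 @ X0 \<and> Z = compl X0 @ Y0
                  \<and> Y = word_pow (Y0 @ X0 @ compl (Y0 @ X0)) (q div 2) @ Y0)
               \<and> broken_alternating Y)
          \<and> (odd q \<longrightarrow>
               (\<exists>X0 Y0. X = Y0 @ X0 \<and> Z = compl X0 @ Y0
                  \<and> Y = word_pow (compl (Y0 @ X0) @ Y0 @ X0) ((q - 1) div 2)
                          @ compl (Y0 @ X0) @ Y0)
               \<and> (q \<noteq> 1 \<longrightarrow> broken_alternating Y))"
    (is "?Q q") if "length X < length Y" "length Y = q * length X + r" "r < length X" for q r
  proof -
    note fact = compl_equation_factorization[OF assms(4) that(2,3)]
    have "broken_alternating Y" if "even q"
    proof -
      obtain X0 Y0 where Y: "Y = word_pow ((Y0 @ X0) @ compl (Y0 @ X0)) (q div 2) @ Y0"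
        using fact \<open>even q\<close> by auto
      \<comment> \<open>For \<open>q = 0\<close>, \<open>Y\<close> would have length
        \<open>r\<close>, below that of \<open>X\<close>. Being even, \<open>q\<close> is thus at
        least 2.\<close>
      have "q \<noteq> 0"
        using \<open>length X < length Y\<close> \<open>length Y = q * length X + r\<close> \<open>r < length X\<close> by (cases q) auto
      with \<open>even q\<close> have "q div 2 > 0"
        by (auto elim: evenE)
      then show ?thesis
        unfolding Y by (rule broken_alternatingI) simp
    qed
    moreover have "broken_alternating Y" if "odd q" "q \<noteq> 1"
    proof -
      \<comment> \<open>Here \<open>w1 = compl (Y0 @ X0)\<close>, with \<open>Y0 @ X0\<close>
        written as a double complement to match the definition; the tail \<open>w1 @ Y0\<close> is a
        left factor of \<open>w1 @ compl w1\<close>.\<close>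
      obtain X0 Y0 where Y: "Y = word_pow (compl (Y0 @ X0) @ compl (compl (Y0 @ X0)))
          ((q - 1) div 2) @ compl (Y0 @ X0) @ Y0"
        using fact \<open>odd q\<close> by auto
      \<comment> \<open>Odd \<open>q\<close> other than 1 is at least 3. At \<open>q = 1\<close> the
        exponent is 0, the situation of \<open>quotient_one_counterexample\<close>.\<close>
      have "(q - 1) div 2 > 0"
        using that by (auto elim: oddE)
      then show ?thesis
        unfolding Y by (rule broken_alternatingI) simp
    qed
    ultimately show ?thesis
      using fact by blast
  qed
  \<comment> \<open>The same prefix comparison as at the bottom of the descent.\<close>
  have short: "\<exists>X1. X = compl Y @ X1 \<and> Z = X1 @ Y" if "length Y < length X"
    using append_eq_append_length_leE[OF assms(4)] that by auto
  have "\<forall>q r. length Y = q * length X + r \<and> 0 \<le> r \<and> r < length X \<longrightarrow> ?Q q"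
    if "length X < length Y"
    using long[OF that] by blast
  with equal short show ?thesis
    unfolding len by blast
qed

end
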